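(* Let $D_0,R,\mu_0>0$, and let $\mathbf g:\mathbb R\times\mathbb C^d\to\mathbb C^d$ be a periodic vector field with Fourier coefficients $\mathbf g_{\boldsymbol\alpha}(t)=[g_{1,\boldsymbol\alpha}(t),\ldots,g_{d,\boldsymbol\alpha}(t)]^T$, $\boldsymbol\alpha\in\mathbb Z^d$, such that (1) $\mathbf g_{\boldsymbol\alpha}(t)=\mathbf 0$ for all $\boldsymbol\alpha\in\mathbb Z^d\setminus\mathbb Z_+^d$ and $t\ge 0$; (2) $\sup_{t\ge 0}\sum_{|\boldsymbol\alpha|=k}\sum_{j=1}^d |g_{j,\boldsymbol\alpha}(t)|\le D_0R^{-k}$ for all integers $k\ge 0$; and (3) $\min_{1\le j\le d}\Im g_{j,\mathbf 0}(t)\ge\mu_0$ for all $t\ge0$. Let $\mathbf x(t)$ be the solution of $\dot{\mathbf x}=\mathbf g(t,\mathbf x)$, $t\ge0$, with initial state $\mathbf x(0)=\mathbf x_0\in\mathbb C^d$ satisfying $$\|\exp(i\mathbf x_0)\|_2<\frac{\mu_0R}{D_0+\mu_0}.$$ For $N\ge1$ let $\mathbf v_{1,N}(t)$ be the first block of the solution of the finite-section approximation of order $N$ of the Carleman-Fourier linearization (defined in the context). Then for every $N\ge1$, $$\|\mathbf v_{1,N}(t)-e^{i\mathbf x(t)}\|_\infty\le\frac{D_0R}{\mu_0}\Big(\frac{(D_0+\mu_0)\|\exp(i\mathbf x_0)\|_2}{\mu_0R}\Big)^N\quad\text{for all }t\ge0 .$$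
   Context: Notation: $\mathbb Z_+^d$ is the set of $d$-tuples of nonnegative integers; for $\boldsymbol\alpha\in\mathbb Z^d$, $|\boldsymbol\alpha|=|\alpha_1|+\cdots+|\alpha_d|$ and $\boldsymbol\alpha\mathbf x=\alpha_1x_1+\cdots+\alpha_dx_d$; $\mathbb Z_{+,k}^d=\{\boldsymbol\alpha\in\mathbb Z_+^d:|\boldsymbol\alpha|=k\}$. $\Im$ denotes imaginary part; $e^{i\mathbf x}=\exp(i\mathbf x)$ is taken componentwise; $\|\cdot\|_p$ is the standard $p$-norm on $\mathbb C^d$, so $\|\exp(i\mathbf x_0)\|_2=(\sum_{j}e^{-2\Im x_{0,j}})^{1/2}$. The periodic vector field $\mathbf g$ is given by its Fourier expansion $\mathbf g(t,\mathbf x)=\sum_{\boldsymbol\alpha\in\mathbb Z^d}\mathbf g_{\boldsymbol\alpha}(t)e^{i\boldsymbol\alpha\mathbf x}$ (which, under (1) and (2), converges when $\min_j\Im x_j>-\ln R$). Finite-section approximation of the Carleman-Fourier linearization: put $$\mathbf B_{k,l}(t)=\big[\,i\,\boldsymbol\alpha^T\mathbf g_{\boldsymbol\beta-\boldsymbol\alpha}(t)\,\big]_{\boldsymbol\alpha\in\mathbb Z_{+,k}^d,\ \boldsymbol\beta\in\mathbb Z_{+,l}^d},\qquad k,l\ge1 .$$ The finite-section approximation of order $N\ge1$ is the finite linear ODE system $$\dot{\mathbf v}_{k,N}(t)=\sum_{l=k}^N\mathbf B_{k,l}(t)\mathbf v_{l,N}(t),\qquad \mathbf v_{k,N}(0)=[e^{i\boldsymbol\alpha\mathbf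 x_0}]_{\boldsymbol\alpha\in\mathbb Z_{+,k}^d},\qquad 1\le k\le N .$$ Its first block $\mathbf v_{1,N}$ is indexed by the unit vectors $\mathbf e_1,\ldots,\mathbf e_d$ and so is regarded as a vector in $\mathbb C^d$. *)

theory Defs
  imports "HOL-Analysis.Analysis"
begin

definition l1_norm :: "int ^ 'd::finite \<Rightarrow> int" where
  "l1_norm \<alpha> = (\<Sum>j\<in>UNIV. \<bar>\<alpha> $ j\<bar>)"

definition nonneg_indices :: "(int ^ 'd::finite) set" where
  "nonneg_indices = {\<alpha>. \<forall>j. \<alpha> $ j \<ge> 0}"

definition nonneg_indices_of_order :: "nat \<Rightarrow> (int ^ 'd::finite) set" where
  "nonneg_indices_of_order k = {\<alpha> \<in> nonneg_indices. l1_norm \<alpha> = int k}"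

lemma finite_l1_sphere: "finite {\<alpha> :: int ^ 'd::finite. l1_norm \<alpha> = int k}"
proof -
  let ?F = "PiE (UNIV :: 'd set) (\<lambda>_. {- int k..int k})"
  have "{\<alpha> :: int ^ 'd. l1_norm \<alpha> = int k} \<subseteq> vec_lambda ` ?F"
  proof
    fix \<alpha> :: "int ^ 'd" assume "\<alpha> \<in> {\<alpha>. l1_norm \<alpha> = int k}"
    then have s: "(\<Sum>j\<in>UNIV. \<bar>\<alpha> $ j\<bar>) = int k" by (simp add: l1_norm_def)
    have b: "\<bar>\<alpha> $ j\<bar> \<le> int k" for j
      unfolding s[symmetric] by (rule member_le_sum) auto
    have "\<alpha> $ j \<in> {- int k..int k}" for j
      using b[of j] by auto
    then have "vec_nth \<alpha> \<in> ?F" by auto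
    then show "\<alpha> \<in> vec_lambda ` ?F" by (metis image_eqI vec_nth_inverse)
  qed
  then show ?thesis by (rule finite_subset) (intro finite_imageI finite_PiE; simp)
qed

lemma finite_nonneg_indices_of_order:
  "finite (nonneg_indices_of_order k :: (int ^ 'd::finite) set)"
  by (rule finite_subset[OF _ finite_l1_sphere[of k]])
    (auto simp: nonneg_indices_of_order_def)

definition fourier_mode :: "int ^ 'd::finite \<Rightarrow> complex ^ 'd \<Rightarrow> complex" where
  "fourier_mode \<alpha> x = exp (\<i> * (\<Sum>j\<in>UNIV. of_int (\<alpha> $ j) * x $ j))"

definition exp_i :: "complex ^ 'd::finite \<Rightarrow> complex ^ 'd" where
  "exp_i x = (\<chi> j. exp (\<i> * x $ j))"

(* Not infnorm, which takes the maximum over real and imaginary parts.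
   The 2-norm of a complex vector is the library's norm. *)
definition linf_norm :: "complex ^ 'd::finite \<Rightarrow> real" where
  "linf_norm z = (MAX j. cmod (z $ j))"

definition periodic_field :: "(real \<Rightarrow> complex ^ 'd::finite \<Rightarrow> complex ^ 'd) \<Rightarrow> bool" where
  "periodic_field g \<longleftrightarrow> (\<forall>t x j. g t (x + axis j (complex_of_real (2 * pi))) = g t x)"

(* The expansion is only required for t \<ge> 0 and on the set of x where the series
   converges absolutely under the decay condition with radius R. If R \<le> 1 this set
   does not contain the real torus, so the coefficients cannot be introduced as
   integrals over it. *)
definition has_fourier_expansion ::
  "(real \<Rightarrow> complex ^ 'd::finite \<Rightarrow> complex ^ 'd) \<Rightarrow> (real \<Rightarrow> int ^ 'd \<Rightarrow> complex ^ 'd) \<Rightarrow> real \<Rightarrow> bool"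
where
  "has_fourier_expansion g gc R \<longleftrightarrow>
     (\<forall>t\<ge>0. \<forall>x. (\<forall>j. Im (x $ j) > - ln R) \<longrightarrow>
        ((\<lambda>\<alpha>. fourier_mode \<alpha> x *s gc t \<alpha>) has_sum g t x) UNIV)"

definition solves_ivp ::
  "(real \<Rightarrow> complex ^ 'd::finite \<Rightarrow> complex ^ 'd) \<Rightarrow> complex ^ 'd \<Rightarrow> (real \<Rightarrow> complex ^ 'd) \<Rightarrow> bool"
where
  "solves_ivp g x0 x \<longleftrightarrow> x 0 = x0 \<and>
     (\<forall>t\<ge>0. (x has_vector_derivative g t (x t)) (at t within {0..}))"

(* Entry (\<alpha>, \<beta>) of the block B_{k,l}(t), where k = |\<alpha>| and l = |\<beta>|. *)
definition carleman_fourier_entry ::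
  "(real \<Rightarrow> int ^ 'd::finite \<Rightarrow> complex ^ 'd) \<Rightarrow> real \<Rightarrow> int ^ 'd \<Rightarrow> int ^ 'd \<Rightarrow> complex" where
  "carleman_fourier_entry gc t \<alpha> \<beta> = \<i> * (\<Sum>j\<in>UNIV. of_int (\<alpha> $ j) * gc t (\<beta> - \<alpha>) $ j)"

(* v k t \<alpha> is the entry of the block v_{k,N}(t) at \<alpha>; only 1 \<le> k \<le> N and
   \<alpha> \<in> nonneg_indices_of_order k are constrained. *)
definition solves_finite_section ::
  "(real \<Rightarrow> int ^ 'd::finite \<Rightarrow> complex ^ 'd) \<Rightarrow> complex ^ 'd \<Rightarrow> nat
    \<Rightarrow> (nat \<Rightarrow> real \<Rightarrow> int ^ 'd \<Rightarrow> complex) \<Rightarrow> bool" where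
  "solves_finite_section gc x0 N v \<longleftrightarrow>
     (\<forall>k\<in>{1..N}. \<forall>\<alpha>\<in>nonneg_indices_of_order k.
        v k 0 \<alpha> = fourier_mode \<alpha> x0 \<and>
        (\<forall>t\<ge>0. ((\<lambda>s. v k s \<alpha>) has_vector_derivative
            (\<Sum>l=k..N. \<Sum>\<beta>\<in>nonneg_indices_of_order l. carleman_fourier_entry gc t \<alpha> \<beta> * v l t \<beta>))
          (at t within {0..})))"

definition first_block ::
  "(nat \<Rightarrow> real \<Rightarrow> int ^ 'd::finite \<Rightarrow> complex) \<Rightarrow> real \<Rightarrow> complex ^ 'd" where
  "first_block v t = (\<chi> j. v 1 t (axis j 1))"

end

theory Submission
  imports Defs
begin

text \<open>
  Put \<open>y j = exp (\<i> * x j)\<close> and \<open>r = norm (exp_i x0)\<close>. Along the solution every mode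
  \<open>y ^ \<alpha>\<close> satisfies a linear equation, in which the constant Fourier coefficient of the field damps
  the modes of degree \<open>k\<close> at rate at least \<open>k * \<mu>\<close>, and in which only modes of higher degree appear
  otherwise. All estimates are made in the sup norm over the multi-indices of a given degree, where
  the block from degree \<open>k\<close> to degree \<open>l\<close> has norm at most \<open>k * D / R ^ (l - k)\<close>. The problem thereby
  reduces to scalar comparison, the same in every dimension.

  Three facts carry the proof. First, the solution is confined
  (\<open>solution_modes_bounded\<close>): as long as all \<open>y j\<close> have modulus at most \<open>\<mu> * R / (D + \<mu>)\<close>, the
  damping dominates the nonconstant modes of the field, so these moduli do not grow, and they stay
  at most \<open>r\<close> forever. Second, the exact modes solve the truncated system up to a defect
  (\<open>truncation_defect\<close>) that is a geometric tail in \<open>z = r / R\<close>, namely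
  \<open>k * D * R ^ k * E\<close> at degree \<open>k\<close>, with \<open>E = z ^ (N + 1) / (1 - z)\<close>. Third, a damped scalar
  equation never exceeds the level where damping balances forcing (\<open>damped_linear_ode_bound\<close>).

  Applied to the error, which vanishes initially, the third fact gives bounds \<open>c k\<close> uniform
  in time, from degree \<open>N\<close> downwards:
  \<open>\<mu> * c k = D * (\<Sum>l=k+1..N. c l / R ^ (l - k)) + D * R ^ k * E\<close>. With \<open>\<delta> = D / \<mu>\<close> the solution
  is \<open>c k = R ^ k * \<delta> * (1 + \<delta>) ^ (N - k) * E\<close> (\<open>finite_section_error\<close>). At \<open>k = 1\<close> the
  smallness of \<open>r\<close>, which is \<open>z < 1 / (1 + \<delta>)\<close>, together with \<open>\<delta> \<ge> 1\<close> turns this into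
  \<open>R * \<delta> * ((1 + \<delta>) * z) ^ N\<close>.
\<close>

section \<open>Differential inequalities on the half-line\<close>

text \<open>
  Look at the last time before \<open>t\<close> at which \<open>\<phi>\<close> was at most \<open>C\<close>: from then on \<open>\<phi>\<close> does not
  grow. Asking only for a pointwise derivative makes integration unnecessary, so the
  coefficients of the equations below need no regularity in time.
\<close>
lemma le_of_derivative_le_zero_above:
  fixes \<phi> \<phi>' :: "real \<Rightarrow> real"
  assumes deriv: "\<And>t. t \<ge> 0 \<Longrightarrow> (\<phi> has_real_derivative \<phi>' t) (at t within {0..})"
    and init: "\<phi> 0 \<le> C"
    and above: "\<And>t. t \<ge> 0 \<Longrightarrow> \<phi> t > C \<Longrightarrow> \<phi>' t \<le> 0"
    and t: "t \<ge> 0"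
  shows "\<phi> t \<le> C"
proof (rule ccontr)
  assume "\<not> \<phi> t \<le> C"
  then have gt: "\<phi> t > C" by simp
  have cont: "continuous_on {0..} \<phi>"
    using deriv by (auto simp: continuous_on_eq_continuous_within intro!: DERIV_continuous)
  define S where "S = {s \<in> {0..t}. \<phi> s \<le> C}"
  have "closed S"
    unfolding S_def
    by (intro continuous_on_closed_Collect_le continuous_on_subset[OF cont] continuous_intros) auto
  moreover have "0 \<in> S" using init t by (simp add: S_def)
  moreover have bdd: "bdd_above S" by (auto simp: S_def bdd_above_def)
  ultimately have SS: "Sup S \<in> S" by (intro closed_contains_Sup) auto
  define s where "s = Sup S"
  have s: "0 \<le> s" "s \<le> t" "\<phi> s \<le> C" using SS by (auto simp: S_def s_def)
  have beyond: "\<phi> u > C" if "s < u" "u \<le> t" for u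
  proof (rule ccontr)
    assume "\<not> \<phi> u > C"
    then have "u \<in> S" using that s by (simp add: S_def)
    then have "u \<le> s" unfolding s_def using bdd by (rule cSup_upper)
    then show False using that by simp
  qed
  have "\<phi> s \<ge> \<phi> t"
  proof (rule DERIV_nonpos_imp_decreasing_open[where f = \<phi> and a = s and b = t])
    fix u assume u: "s < u" "u < t"
    then have "at u within {0..} = at u"
      using s by (intro at_within_interior) (simp add: interior_real_atLeast)
    then show "\<exists>y. DERIV \<phi> u :> y \<and> y \<le> 0"
      using deriv[of u] above[of u] beyond[of u] u s by auto
  next
    show "continuous_on {s..t} \<phi>" using cont by (rule continuous_on_subset) (use s in auto)
  qed (use s in auto)
  with s gt show False by simp
qed

text \<open>
  The level \<open>c\<close> is where the damping \<open>\<kappa> * cmod (f t)\<close> balances the largest possible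
  forcing \<open>\<kappa> * c\<close>, so the modulus cannot cross it. The estimate is made for the squared modulus,
  which is differentiable also at the zeros of \<open>f\<close>.
\<close>
lemma damped_linear_ode_bound:
  fixes f \<sigma> h :: "real \<Rightarrow> complex"
  assumes deriv: "\<And>t. t \<ge> 0 \<Longrightarrow> (f has_vector_derivative \<sigma> t * f t + h t) (at t within {0..})"
    and damp: "\<And>t. t \<ge> 0 \<Longrightarrow> Re (\<sigma> t) \<le> - \<kappa>"
    and forcing: "\<And>t. t \<ge> 0 \<Longrightarrow> cmod (h t) \<le> \<kappa> * c"
    and "\<kappa> > 0" and init: "cmod (f 0) \<le> c" and t: "t \<ge> 0"
  shows "cmod (f t) \<le> c"
proof -
  have c: "c \<ge> 0" using init norm_ge_zero order_trans by blast
  have "(cmod (f t))\<^sup>2 \<le> c\<^sup>2"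
  proof (rule le_of_derivative_le_zero_above
      [where \<phi> = "\<lambda>t. (cmod (f t))\<^sup>2" and \<phi>' = "\<lambda>t. 2 * (f t \<bullet> (\<sigma> t * f t + h t))"])
    fix t :: real assume "t \<ge> 0"
    then show "((\<lambda>t. (cmod (f t))\<^sup>2) has_real_derivative 2 * (f t \<bullet> (\<sigma> t * f t + h t)))
        (at t within {0..})"
      using bounded_bilinear.has_vector_derivative[OF bounded_bilinear_inner deriv deriv, of t]
      by (simp add: has_real_derivative_iff_has_vector_derivative power2_norm_eq_inner
          inner_commute[of _ "f t"])
  next
    show "(cmod (f 0))\<^sup>2 \<le> c\<^sup>2" using init by (intro power_mono) auto
  next
    fix t :: real assume t: "t \<ge> 0" and gt: "(cmod (f t))\<^sup>2 > c\<^sup>2"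
    have gt: "cmod (f t) > c" using gt by (meson norm_ge_zero power_less_imp_less_base)
    have "f t \<bullet> (\<sigma> t * f t) = Re (\<sigma> t) * (cmod (f t))\<^sup>2"
      unfolding cmod_power2 by (simp add: inner_complex_def algebra_simps power2_eq_square)
    also have "\<dots> \<le> - \<kappa> * (cmod (f t))\<^sup>2"
      using damp[OF t] by (intro mult_right_mono) auto
    finally have 1: "f t \<bullet> (\<sigma> t * f t) \<le> - \<kappa> * (cmod (f t))\<^sup>2" .
    have "f t \<bullet> h t \<le> cmod (f t) * cmod (h t)" by (rule norm_cauchy_schwarz)
    also have "\<dots> \<le> cmod (f t) * (\<kappa> * c)" using forcing[OF t] by (intro mult_left_mono) auto
    also have "\<dots> \<le> cmod (f t) * (\<kappa> * cmod (f t))"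
      using gt \<open>\<kappa> > 0\<close> by (intro mult_left_mono) auto
    finally have 2: "f t \<bullet> h t \<le> \<kappa> * (cmod (f t))\<^sup>2" by (simp add: power2_eq_square mult_ac)
    show "2 * (f t \<bullet> (\<sigma> t * f t + h t)) \<le> 0" using 1 2 by (simp add: inner_add_right)
  qed (rule t)
  then show ?thesis using c by (rule power2_le_imp_le)
qed

section \<open>Multi-indices and Fourier modes\<close>

lemma l1_norm_nonneg: "l1_norm \<alpha> \<ge> 0"
  by (simp add: l1_norm_def sum_nonneg)

lemma l1_norm_add:
  "\<alpha> \<in> nonneg_indices \<Longrightarrow> \<gamma> \<in> nonneg_indices \<Longrightarrow> l1_norm (\<alpha> + \<gamma>) = l1_norm \<alpha> + l1_norm \<gamma>"
  by (simp add: l1_norm_def nonneg_indices_def sum.distrib)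

lemma l1_norm_eq_sum: "\<alpha> \<in> nonneg_indices \<Longrightarrow> l1_norm \<alpha> = (\<Sum>j\<in>UNIV. \<alpha> $ j)"
  by (simp add: l1_norm_def nonneg_indices_def)

lemma zero_shell: "{\<gamma> :: int ^ 'd::finite. l1_norm \<gamma> = 0} = {0}"
  by (auto simp: l1_norm_def sum_nonneg_eq_0_iff vec_eq_iff)

lemma axis_in_order_1: "axis j 1 \<in> (nonneg_indices_of_order 1 :: (int ^ 'd::finite) set)"
proof -
  have "axis j 1 \<in> (nonneg_indices :: (int ^ 'd) set)"
    by (simp add: nonneg_indices_def axis_def)
  moreover have "(\<Sum>i\<in>UNIV. (axis j 1 :: int ^ 'd) $ i) = 1"
    by (simp add: axis_def sum.delta)
  ultimately show ?thesis
    by (simp add: nonneg_indices_of_order_def l1_norm_eq_sum)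
qed

lemma sum_axis_mult:
  "(\<Sum>i\<in>UNIV. of_int ((axis j 1 :: int ^ 'd::finite) $ i) * z i) = (z j :: complex)"
proof -
  have "(\<Sum>i\<in>UNIV. of_int ((axis j 1 :: int ^ 'd) $ i) * z i) = (\<Sum>i\<in>UNIV. if i = j then z i else 0)"
    by (intro sum.cong) (auto simp: axis_def)
  then show ?thesis by simp
qed

lemma fourier_mode_axis: "fourier_mode (axis j 1) x = exp (\<i> * x $ j)"
  by (simp add: fourier_mode_def sum_axis_mult)

lemma fourier_mode_0: "fourier_mode 0 x = 1"
  by (simp add: fourier_mode_def)

lemma fourier_mode_add: "fourier_mode (\<alpha> + \<gamma>) x = fourier_mode \<alpha> x * fourier_mode \<gamma> x"
  by (simp add: fourier_mode_def exp_add[symmetric] algebra_simps sum.distrib)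

text \<open>
  The hypothesis on \<open>x\<close> says that all \<open>exp (\<i> * x $ j)\<close> have modulus at most \<open>r\<close>. In this
  logarithmic form it speaks about \<open>Im (x $ j)\<close>, whose derivative along a trajectory is simply a
  component of the field.
\<close>
lemma cmod_fourier_mode_le:
  assumes \<gamma>: "\<gamma> \<in> nonneg_indices" "l1_norm \<gamma> = int m" and "r > 0"
    and x: "\<And>j. - ln r \<le> Im (x $ j)"
  shows "cmod (fourier_mode \<gamma> x) \<le> r ^ m"
proof -
  have "cmod (fourier_mode \<gamma> x) = exp (\<Sum>j\<in>UNIV. of_int (\<gamma> $ j) * - Im (x $ j))"
    by (simp add: fourier_mode_def sum_negf)
  also have "\<dots> \<le> exp (\<Sum>j\<in>UNIV. of_int (\<gamma> $ j) * ln r)"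
    using \<gamma>(1) x unfolding exp_le_cancel_iff
    by (intro sum_mono mult_left_mono) (auto simp: nonneg_indices_def minus_le_iff[of "ln r"])
  also have "(\<Sum>j\<in>UNIV. of_int (\<gamma> $ j) * ln r) = real m * ln r"
    using \<gamma> by (simp add: l1_norm_eq_sum sum_distrib_right[symmetric] of_int_sum[symmetric]
        del: of_int_sum)
  also have "exp (real m * ln r) = r ^ m"
    using \<open>r > 0\<close> by (simp add: exp_of_nat_mult)
  finally show ?thesis .
qed

text \<open>
  Entries of the Carleman-Fourier matrix vanish unless \<open>\<beta> - \<alpha>\<close> is a nonnegative index, so the
  row of \<open>\<alpha>\<close> in the block from level \<open>k\<close> to level \<open>k + m\<close> is indexed by the sphere of radius \<open>m\<close>.
  This is used both for the matrix action and for the row sums of absolute values.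
\<close>
lemma sum_shifted_shell:
  fixes G :: "int ^ 'd::finite \<Rightarrow> 'a::comm_monoid_add"
  assumes \<alpha>: "\<alpha> \<in> nonneg_indices_of_order k"
    and zero: "\<And>\<beta>. \<beta> - \<alpha> \<notin> nonneg_indices \<Longrightarrow> G \<beta> = 0"
  shows "(\<Sum>\<beta>\<in>nonneg_indices_of_order (k + m). G \<beta>) = (\<Sum>\<gamma> | l1_norm \<gamma> = int m. G (\<alpha> + \<gamma>))"
proof -
  have \<alpha>': "\<alpha> \<in> nonneg_indices" "l1_norm \<alpha> = int k"
    using \<alpha> by (auto simp: nonneg_indices_of_order_def)
  have "(\<Sum>\<gamma> | l1_norm \<gamma> = int m. G (\<alpha> + \<gamma>)) = (\<Sum>\<gamma>\<in>nonneg_indices_of_order m. G (\<alpha> + \<gamma>))"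
    by (intro sum.mono_neutral_right finite_l1_sphere ballI zero)
      (auto simp: nonneg_indices_of_order_def)
  also have "\<dots> = sum G ((+) \<alpha> ` nonneg_indices_of_order m)"
    by (simp add: sum.reindex)
  also have "\<dots> = (\<Sum>\<beta>\<in>nonneg_indices_of_order (k + m). G \<beta>)"
  proof (intro sum.mono_neutral_left finite_nonneg_indices_of_order ballI zero)
    show "(+) \<alpha> ` nonneg_indices_of_order m \<subseteq> nonneg_indices_of_order (k + m)"
      using \<alpha>' l1_norm_add[of \<alpha>]
      by (auto simp: nonneg_indices_of_order_def) (auto simp: nonneg_indices_def)
  next
    fix \<beta> assume \<beta>: "\<beta> \<in> nonneg_indices_of_order (k + m) - (+) \<alpha> ` nonneg_indices_of_order m"
    show "\<beta> - \<alpha> \<notin> nonneg_indices"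
    proof
      assume nn: "\<beta> - \<alpha> \<in> nonneg_indices"
      then have "l1_norm (\<beta> - \<alpha>) = int m"
        using l1_norm_add[OF \<alpha>'(1) nn] \<alpha>' \<beta> by (auto simp: nonneg_indices_of_order_def)
      then have "\<beta> \<in> (+) \<alpha> ` nonneg_indices_of_order m"
        using nn by (intro image_eqI[of _ _ "\<beta> - \<alpha>"]) (auto simp: nonneg_indices_of_order_def)
      with \<beta> show False by simp
    qed
  qed
  finally show ?thesis by simp
qed

section \<open>Series summed over spheres of multi-indices\<close>
lemma sum_geometric_segment_le:
  fixes z :: real
  assumes "0 \<le> z" "z < 1"
  shows "(\<Sum>m=Suc n..M. z ^ m) \<le> z ^ (n + 1) / (1 - z)"
proof (cases "Suc n \<le> M")
  case True
  then have "(1 - z) * (\<Sum>m=Suc n..M. z ^ m) = z ^ Suc n - z ^ Suc M"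
    by (rule sum_gp_multiplied)
  also have "\<dots> \<le> z ^ (n + 1)" using assms by simp
  finally show ?thesis using assms by (simp add: pos_le_divide_eq mult.commute)
qed (use assms in auto)

text \<open>
  A finite set containing the ball of radius \<open>n\<close> exceeds it only by points on finitely many
  larger spheres, and the geometric bound applies to each of them. So the estimate holds for all
  sufficiently large partial sums and passes to the limit.
\<close>
lemma has_sum_shells_tail:
  fixes f :: "int ^ 'd::finite \<Rightarrow> 'a::real_normed_vector"
  assumes sum: "(f has_sum s) UNIV"
    and shell: "\<And>m. (\<Sum>\<gamma> | l1_norm \<gamma> = int m. norm (f \<gamma>)) \<le> K * z ^ m"
    and z: "0 \<le> z" "z < 1" and K: "0 \<le> K"
  shows "norm (s - (\<Sum>m\<le>n. \<Sum>\<gamma> | l1_norm \<gamma> = int m. f \<gamma>)) \<le> K * (z ^ (n + 1) / (1 - z))"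
proof -
  define B where "B = (\<Union>m\<le>n. {\<gamma> :: int ^ 'd. l1_norm \<gamma> = int m})"
  have finB: "finite B" unfolding B_def using finite_l1_sphere by auto
  have sumB: "sum f B = (\<Sum>m\<le>n. \<Sum>\<gamma> | l1_norm \<gamma> = int m. f \<gamma>)"
    unfolding B_def by (subst sum.UNION_disjoint) (auto simp: finite_l1_sphere)
  have outside: "norm (sum f F - sum f B) \<le> K * (z ^ (n + 1) / (1 - z))"
    if F: "finite F" "B \<subseteq> F" for F
  proof -
    define p where "p = (\<lambda>\<gamma> :: int ^ 'd. nat (l1_norm \<gamma>))"
    define M where "M = Max (insert 0 (p ` F))"
    have p: "p \<gamma> = m \<longleftrightarrow> l1_norm \<gamma> = int m" for \<gamma> m
      using l1_norm_nonneg[of \<gamma>] by (auto simp: p_def)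
    have pM: "p ` (F - B) \<subseteq> {Suc n..M}"
    proof
      fix m assume "m \<in> p ` (F - B)"
      then obtain \<gamma> where \<gamma>: "\<gamma> \<in> F" "\<gamma> \<notin> B" "m = p \<gamma>" by auto
      have "m \<le> M" unfolding M_def using \<gamma> F by (intro Max_ge) auto
      moreover have "\<not> m \<le> n" using \<gamma> p[of \<gamma> m] by (auto simp: B_def)
      ultimately show "m \<in> {Suc n..M}" by simp
    qed
    have "norm (sum f F - sum f B) = norm (sum f (F - B))"
      using F by (simp add: sum_diff)
    also have "\<dots> \<le> (\<Sum>\<gamma>\<in>F - B. norm (f \<gamma>))" by (rule norm_sum)
    also have "\<dots> = (\<Sum>m=Suc n..M. \<Sum>\<gamma> | \<gamma> \<in> F - B \<and> p \<gamma> = m. norm (f \<gamma>))"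
      using sum.group[of "F - B" "{Suc n..M}" p "\<lambda>\<gamma>. norm (f \<gamma>)"] F pM by simp
    also have "\<dots> \<le> (\<Sum>m=Suc n..M. K * z ^ m)"
    proof (rule sum_mono)
      fix m
      have "(\<Sum>\<gamma> | \<gamma> \<in> F - B \<and> p \<gamma> = m. norm (f \<gamma>)) \<le> (\<Sum>\<gamma> | l1_norm \<gamma> = int m. norm (f \<gamma>))"
        by (intro sum_mono2 finite_l1_sphere) (auto simp: p)
      also have "\<dots> \<le> K * z ^ m" by (rule shell)
      finally show "(\<Sum>\<gamma> | \<gamma> \<in> F - B \<and> p \<gamma> = m. norm (f \<gamma>)) \<le> K * z ^ m" .
    qed
    also have "\<dots> \<le> K * (z ^ (n + 1) / (1 - z))"
      unfolding sum_distrib_left[symmetric]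
      using sum_geometric_segment_le[OF z] K by (rule mult_left_mono)
    finally show ?thesis .
  qed
  have lim: "((\<lambda>F. sum f F - sum f B) \<longlongrightarrow> s - sum f B) (finite_subsets_at_top UNIV)"
    using sum unfolding has_sum_def by (intro tendsto_intros)
  have "norm (s - sum f B) \<le> K * (z ^ (n + 1) / (1 - z))"
  proof (rule Lim_norm_ubound[OF _ lim])
    show "\<forall>\<^sub>F F in finite_subsets_at_top UNIV.
        norm (sum f F - sum f B) \<le> K * (z ^ (n + 1) / (1 - z))"
      unfolding eventually_finite_subsets_at_top using finB outside by blast
  qed simp
  then show ?thesis by (simp only: sumB)
qed

section \<open>Dissipative fields with one-sided spectrum\<close>

locale dissipative_field =
  fixes D R \<mu> :: real
    and g :: "real \<Rightarrow> complex ^ 'd::finite \<Rightarrow> complex ^ 'd"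
    and gc :: "real \<Rightarrow> int ^ 'd \<Rightarrow> complex ^ 'd"
  assumes D_pos: "D > 0" and R_pos: "R > 0" and \<mu>_pos: "\<mu> > 0"
    and expansion: "has_fourier_expansion g gc R"
    and gc_zero: "\<And>\<alpha> t. \<alpha> \<notin> nonneg_indices \<Longrightarrow> t \<ge> 0 \<Longrightarrow> gc t \<alpha> = 0"
    and decay: "\<And>m t. t \<ge> 0 \<Longrightarrow>
      (\<Sum>\<gamma> | l1_norm \<gamma> = int m. \<Sum>j\<in>UNIV. cmod (gc t \<gamma> $ j)) \<le> D / R ^ m"
    and dissipation: "\<And>t j. t \<ge> 0 \<Longrightarrow> Im (gc t 0 $ j) \<ge> \<mu>"
begin

lemma entry_eq_0:
  "\<beta> - \<alpha> \<notin> nonneg_indices \<Longrightarrow> t \<ge> 0 \<Longrightarrow> carleman_fourier_entry gc t \<alpha> \<beta> = 0"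
  by (simp add: carleman_fourier_entry_def gc_zero)

text \<open>
  Row sums control the operator norm of the block from level \<open>k\<close> to level \<open>k + m\<close> in
  the sup norm. Each component of \<open>\<alpha>\<close> is at most \<open>k\<close>; this factor is harmless because the
  damping at level \<open>k\<close> grows at the same rate.
\<close>
lemma entry_shell_bound:
  assumes \<alpha>: "\<alpha> \<in> nonneg_indices_of_order k" and t: "t \<ge> 0"
  shows "(\<Sum>\<gamma> | l1_norm \<gamma> = int m. cmod (carleman_fourier_entry gc t \<alpha> (\<alpha> + \<gamma>))) \<le> real k * (D / R ^ m)"
proof -
  have \<alpha>': "0 \<le> \<alpha> $ j" "\<alpha> $ j \<le> int k" for j
  proof -
    show "0 \<le> \<alpha> $ j" using \<alpha> by (simp add: nonneg_indices_of_order_def nonneg_indices_def)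
    have "\<bar>\<alpha> $ j\<bar> \<le> l1_norm \<alpha>" unfolding l1_norm_def by (rule member_le_sum) auto
    then show "\<alpha> $ j \<le> int k" using \<alpha> by (simp add: nonneg_indices_of_order_def)
  qed
  have entry: "cmod (carleman_fourier_entry gc t \<alpha> (\<alpha> + \<gamma>)) \<le> real k * (\<Sum>j\<in>UNIV. cmod (gc t \<gamma> $ j))" for \<gamma>
  proof -
    have "cmod (carleman_fourier_entry gc t \<alpha> (\<alpha> + \<gamma>)) \<le> (\<Sum>j\<in>UNIV. cmod (of_int (\<alpha> $ j) * gc t \<gamma> $ j))"
      by (simp add: carleman_fourier_entry_def norm_mult[of \<i>] norm_sum)
    also have "\<dots> \<le> (\<Sum>j\<in>UNIV. real k * cmod (gc t \<gamma> $ j))"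
    proof (rule sum_mono)
      fix j
      have "\<bar>real_of_int (\<alpha> $ j)\<bar> \<le> real k" using \<alpha>'[of j] by linarith
      then show "cmod (of_int (\<alpha> $ j) * gc t \<gamma> $ j) \<le> real k * cmod (gc t \<gamma> $ j)"
        unfolding norm_mult norm_of_int by (rule mult_right_mono) simp
    qed
    finally show ?thesis by (simp add: sum_distrib_left)
  qed
  have "(\<Sum>\<gamma> | l1_norm \<gamma> = int m. cmod (carleman_fourier_entry gc t \<alpha> (\<alpha> + \<gamma>)))
      \<le> (\<Sum>\<gamma> | l1_norm \<gamma> = int m. real k * (\<Sum>j\<in>UNIV. cmod (gc t \<gamma> $ j)))"
    by (intro sum_mono entry)
  also have "\<dots> = real k * (\<Sum>\<gamma> | l1_norm \<gamma> = int m. \<Sum>j\<in>UNIV. cmod (gc t \<gamma> $ j))"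
    by (simp add: sum_distrib_left)
  also have "\<dots> \<le> real k * (D / R ^ m)"
    using decay[OF t] by (intro mult_left_mono) auto
  finally show ?thesis .
qed

text \<open>
  The factor \<open>\<i>\<close> turns the imaginary parts of the mean field into damping.
\<close>
lemma Re_diagonal_entry_le:
  assumes \<alpha>: "\<alpha> \<in> nonneg_indices_of_order k" and t: "t \<ge> 0"
  shows "Re (carleman_fourier_entry gc t \<alpha> \<alpha>) \<le> - (real k * \<mu>)"
proof -
  have "real k * \<mu> = (\<Sum>j\<in>UNIV. of_int (\<alpha> $ j) * \<mu>)"
  proof -
    have "int k = (\<Sum>j\<in>UNIV. \<alpha> $ j)"
      using \<alpha> by (auto simp: nonneg_indices_of_order_def l1_norm_eq_sum)
    then have "real k = (\<Sum>j\<in>UNIV. of_int (\<alpha> $ j))"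
      by (metis of_int_of_nat_eq of_int_sum)
    then show ?thesis by (simp add: sum_distrib_right)
  qed
  also have "\<dots> \<le> (\<Sum>j\<in>UNIV. of_int (\<alpha> $ j) * Im (gc t 0 $ j))"
    using \<alpha> dissipation[OF t]
    by (intro sum_mono mult_left_mono) (auto simp: nonneg_indices_of_order_def nonneg_indices_def)
  finally show ?thesis by (simp add: carleman_fourier_entry_def)
qed

text \<open>
  The first term below is the logarithmic derivative of the mode \<open>\<alpha>\<close> along a trajectory through
  \<open>x\<close>. The bounded linear map \<open>z \<mapsto> \<i> * (\<Sum>j. \<alpha> j * z j)\<close> carries the expansion of the field to
  a series with the Carleman-Fourier entries as coefficients, which is then cut at degree \<open>n\<close>.
\<close>
lemma mode_rate_tail:
  assumes \<alpha>: "\<alpha> \<in> nonneg_indices_of_order k" and t: "t \<ge> 0"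
    and r: "0 < r" "r < R" and x: "\<And>j. - ln r \<le> Im (x $ j)"
  shows "cmod (\<i> * (\<Sum>j\<in>UNIV. of_int (\<alpha> $ j) * g t x $ j)
      - (\<Sum>m\<le>n. \<Sum>\<gamma> | l1_norm \<gamma> = int m. carleman_fourier_entry gc t \<alpha> (\<alpha> + \<gamma>) * fourier_mode \<gamma> x))
    \<le> real k * D * ((r / R) ^ (n + 1) / (1 - r / R))"
proof (rule has_sum_shells_tail)
  define L where "L = (\<lambda>z :: complex ^ 'd. \<i> * (\<Sum>j\<in>UNIV. of_int (\<alpha> $ j) * z $ j))"
  have L: "bounded_linear L"
    unfolding L_def
    by (intro bounded_linear_const_mult bounded_linear_sum bounded_linear_vec_nth)
  have "- ln R < Im (x $ j)" for j
    using x[of j] r ln_less_cancel_iff[of r R] by linarith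
  then have "((\<lambda>\<gamma>. fourier_mode \<gamma> x *s gc t \<gamma>) has_sum g t x) UNIV"
    using expansion t by (simp add: has_fourier_expansion_def)
  from has_sum_bounded_linear[OF L this]
  show "((\<lambda>\<gamma>. carleman_fourier_entry gc t \<alpha> (\<alpha> + \<gamma>) * fourier_mode \<gamma> x) has_sum
      \<i> * (\<Sum>j\<in>UNIV. of_int (\<alpha> $ j) * g t x $ j)) UNIV"
    by (simp add: L_def carleman_fourier_entry_def sum_distrib_left sum_distrib_right mult_ac)
  show "(\<Sum>\<gamma> | l1_norm \<gamma> = int m. norm (carleman_fourier_entry gc t \<alpha> (\<alpha> + \<gamma>) * fourier_mode \<gamma> x))
      \<le> real k * D * (r / R) ^ m" for m
  proof -
    have "(\<Sum>\<gamma> | l1_norm \<gamma> = int m. norm (carleman_fourier_entry gc t \<alpha> (\<alpha> + \<gamma>) * fourier_mode \<gamma> x))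
        \<le> (\<Sum>\<gamma> | l1_norm \<gamma> = int m. cmod (carleman_fourier_entry gc t \<alpha> (\<alpha> + \<gamma>)) * r ^ m)"
    proof (rule sum_mono)
      fix \<gamma> :: "int ^ 'd" assume "\<gamma> \<in> {\<gamma>. l1_norm \<gamma> = int m}"
      then show "norm (carleman_fourier_entry gc t \<alpha> (\<alpha> + \<gamma>) * fourier_mode \<gamma> x)
          \<le> cmod (carleman_fourier_entry gc t \<alpha> (\<alpha> + \<gamma>)) * r ^ m"
        using cmod_fourier_mode_le[of \<gamma> m r x] r(1) x entry_eq_0[of "\<alpha> + \<gamma>" \<alpha> t] t
        by (cases "\<gamma> \<in> nonneg_indices") (auto simp: norm_mult intro!: mult_left_mono)
    qed
    also have "\<dots> \<le> real k * (D / R ^ m) * r ^ m"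
      unfolding sum_distrib_right[symmetric]
      using entry_shell_bound[OF \<alpha> t] r by (intro mult_right_mono) auto
    finally show ?thesis by (simp add: power_divide)
  qed
qed (use r R_pos D_pos in auto)

end

section \<open>Confinement of the exact solution\<close>

lemma solves_ivp_component:
  assumes "solves_ivp g x0 x" "t \<ge> 0"
  shows "((\<lambda>t. x t $ j) has_vector_derivative g t (x t) $ j) (at t within {0..})"
  using assms by (intro bounded_linear.has_vector_derivative[OF bounded_linear_vec_nth])
    (simp add: solves_ivp_def)

lemma solves_ivp_Im:
  assumes "solves_ivp g x0 x" "t \<ge> 0"
  shows "((\<lambda>t. Im (x t $ j)) has_real_derivative Im (g t (x t) $ j)) (at t within {0..})"
  unfolding has_real_derivative_iff_has_vector_derivative
  by (rule bounded_linear.has_vector_derivative[OF bounded_linear_Im solves_ivp_component[OF assms]])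

text \<open>
  Each mode satisfies a linear equation along the trajectory, whose rate still depends on the
  solution; expanding this rate into modes gives the infinite linear system.
\<close>
lemma has_vector_derivative_fourier_mode:
  assumes "solves_ivp g x0 x" "t \<ge> 0"
  shows "((\<lambda>t. fourier_mode \<alpha> (x t)) has_vector_derivative
      \<i> * (\<Sum>j\<in>UNIV. of_int (\<alpha> $ j) * g t (x t) $ j) * fourier_mode \<alpha> (x t)) (at t within {0..})"
proof -
  have "((\<lambda>t. \<i> * (\<Sum>j\<in>UNIV. of_int (\<alpha> $ j) * x t $ j)) has_vector_derivative
      \<i> * (\<Sum>j\<in>UNIV. of_int (\<alpha> $ j) * g t (x t) $ j)) (at t within {0..})"
    by (intro has_vector_derivative_mult_right has_vector_derivative_sum solves_ivp_component[OF assms])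
  from field_vector_diff_chain_within[OF this DERIV_exp[THEN has_field_derivative_at_within]]
  show ?thesis by (simp add: fourier_mode_def o_def)
qed

context dissipative_field
begin

text \<open>
  A diagonal entry has modulus at least \<open>\<mu>\<close>, its damping, and at most \<open>D\<close>, its share of the
  coefficients of degree zero.
\<close>
lemma dissipation_le_size: "\<mu> \<le> D"
proof -
  fix j :: 'd
  let ?\<alpha> = "axis j 1 :: int ^ 'd"
  have "\<mu> \<le> cmod (carleman_fourier_entry gc 0 ?\<alpha> ?\<alpha>)"
    using Re_diagonal_entry_le[OF axis_in_order_1, of 0 j]
      abs_Re_le_cmod[of "carleman_fourier_entry gc 0 ?\<alpha> ?\<alpha>"] by simp
  also have "\<dots> \<le> D"
    using entry_shell_bound[OF axis_in_order_1, of 0 j 0] by (simp add: zero_shell)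
  finally show ?thesis .
qed

text \<open>
  The critical radius \<open>r = \<mu> * R / (D + \<mu>)\<close> solves \<open>D * (r / R) / (1 - r / R) = \<mu>\<close>: there
  the nonconstant modes of the field can just cancel the damping from its mean.
\<close>
lemma Im_g_nonneg:
  assumes t: "t \<ge> 0" and x: "\<And>j. - ln (\<mu> * R / (D + \<mu>)) \<le> Im (x $ j)"
  shows "Im (g t x $ j) \<ge> 0"
proof -
  define r where "r = \<mu> * R / (D + \<mu>)"
  have r: "0 < r" "r < R"
    using D_pos R_pos \<mu>_pos by (auto simp: r_def divide_simps algebra_simps)
  have z: "r / R = \<mu> / (D + \<mu>)" using R_pos by (simp add: r_def)
  have omz: "1 - r / R = D / (D + \<mu>)" unfolding z using D_pos \<mu>_pos by (simp add: field_simps)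
  then have tail: "D * ((r / R) ^ (0 + 1) / (1 - r / R)) = \<mu>"
    unfolding omz z using D_pos \<mu>_pos by simp
  have "cmod (\<i> * g t x $ j - \<i> * gc t 0 $ j) \<le> \<mu>"
    using mode_rate_tail[OF axis_in_order_1[of j] t r x[folded r_def], where n = 0]
    unfolding sum_axis_mult of_nat_1 mult_1 tail
    by (simp add: zero_shell fourier_mode_0 carleman_fourier_entry_def sum_axis_mult)
  then have "cmod (g t x $ j - gc t 0 $ j) \<le> \<mu>"
    by (simp add: right_diff_distrib[symmetric] norm_mult)
  then show ?thesis
    using abs_Im_le_cmod[of "g t x $ j - gc t 0 $ j"] dissipation[OF t, of j] by simp
qed

text \<open>
  While all modes stay below the critical radius, no \<open>Im (x t $ j)\<close> decreases. Up to a first time at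
  which a mode reached that radius, the moduli would thus not have grown, although they started
  strictly below it; so there is no such time, and the initial radius \<open>r\<close> is kept forever.
\<close>
lemma solution_modes_bounded:
  assumes ivp: "solves_ivp g x0 x" and t: "t \<ge> 0"
    and r: "0 < r" "r < \<mu> * R / (D + \<mu>)" and init: "\<And>j. - ln r \<le> Im (x0 $ j)"
  shows "- ln r \<le> Im (x t $ j)"
proof -
  \<comment> \<open>The logarithmic form of the critical radius.\<close>
  define a where "a = - ln (\<mu> * R / (D + \<mu>))"
  have a: "a < - ln r" using r D_pos R_pos \<mu>_pos by (simp add: a_def)
  have x0: "x 0 = x0" using ivp by (simp add: solves_ivp_def)
  have cont: "continuous_on {0..} (\<lambda>t. Im (x t $ j))" for j
    using solves_ivp_Im[OF ivp]
    by (auto simp: continuous_on_eq_continuous_within intro!: DERIV_continuous)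
  have grow: "- ln r \<le> Im (x T $ j)"
    if T: "T \<ge> 0" and above: "\<And>s j. 0 \<le> s \<Longrightarrow> s < T \<Longrightarrow> a < Im (x s $ j)" for T j
  proof -
    have "Im (x 0 $ j) \<le> Im (x T $ j)"
    proof (rule DERIV_nonneg_imp_increasing_open[where f = "\<lambda>t. Im (x t $ j)" and a = 0 and b = T])
      fix s assume s: "0 < s" "s < T"
      then have "at s within {0..} = at s"
        by (intro at_within_interior) (simp add: interior_real_atLeast)
      moreover have "Im (g s (x s) $ j) \<ge> 0"
        using s above by (intro Im_g_nonneg) (auto simp: a_def less_imp_le)
      ultimately show "\<exists>y. DERIV (\<lambda>t. Im (x t $ j)) s :> y \<and> y \<ge> 0"
        using solves_ivp_Im[OF ivp, of s j] s by auto
    next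
      show "continuous_on {0..T} (\<lambda>t. Im (x t $ j))" using cont by (rule continuous_on_subset) auto
    qed (rule T)
    then show ?thesis using init[of j] x0 by simp
  qed
  define S where "S = {t \<in> {0..}. \<exists>j. Im (x t $ j) \<le> a}"
  have "S = {}"
  proof (rule ccontr)
    assume ne: "S \<noteq> {}"
    have "S = (\<Union>j. {t \<in> {0..}. Im (x t $ j) \<le> a})" by (auto simp: S_def)
    also have "closed \<dots>"
      by (intro closed_UN finite ballI continuous_on_closed_Collect_le cont continuous_intros)
    finally have "closed S" .
    moreover have bdd: "bdd_below S" by (auto simp: S_def bdd_below_def)
    ultimately have "Inf S \<in> S" using ne by (intro closed_contains_Inf)
    then obtain j where j: "0 \<le> Inf S" "Im (x (Inf S) $ j) \<le> a" by (auto simp: S_def)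
    have "- ln r \<le> Im (x (Inf S) $ j)"
    proof (rule grow)
      fix s i assume s: "0 \<le> s" "s < Inf S"
      then have "s \<notin> S" using cInf_lower[OF _ bdd] by force
      then show "a < Im (x s $ i)" using s by (auto simp: S_def not_le)
    qed (rule j)
    with j a show False by simp
  qed
  have "a < Im (x s $ j)" if "0 \<le> s" for s j
  proof (rule ccontr)
    assume "\<not> a < Im (x s $ j)"
    then have "s \<in> S" using that by (auto simp: S_def not_less)
    with \<open>S = {}\<close> show False by simp
  qed
  with t show ?thesis by (intro grow)
qed

end

section \<open>Error of the finite section\<close>

text \<open>
  This is the closed form of the back substitution in the error recursion: if
  \<open>d N = \<delta> * E\<close> and each lower \<open>d k\<close> equals \<open>\<delta>\<close> times the sum of \<open>E\<close> and of all
  \<open>d l\<close> above it, then \<open>d k = (1 + \<delta>) * d (Suc k)\<close>, so \<open>d k = \<delta> * (1 + \<delta>) ^ (N - k) * E\<close>.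
\<close>
lemma geometric_feedback:
  fixes \<delta> :: real
  assumes "k \<le> N"
  shows "\<delta> * (\<Sum>l=Suc k..N. (1 + \<delta>) ^ (N - l)) + 1 = (1 + \<delta>) ^ (N - k)"
  using assms
proof (induction k rule: inc_induct)
  case (step k)
  then have "N - k = Suc (N - Suc k)" by simp
  moreover have "(\<Sum>l=Suc k..N. (1 + \<delta>) ^ (N - l))
      = (1 + \<delta>) ^ (N - Suc k) + (\<Sum>l=Suc (Suc k)..N. (1 + \<delta>) ^ (N - l))"
    using step by (simp add: sum.atLeast_Suc_atMost)
  ultimately show ?case using step by (simp add: algebra_simps)
qed simp

context dissipative_field
begin

lemma sum_level_entries:
  assumes \<alpha>: "\<alpha> \<in> nonneg_indices_of_order k" and t: "t \<ge> 0"
  shows "(\<Sum>\<beta>\<in>nonneg_indices_of_order (k + m). carleman_fourier_entry gc t \<alpha> \<beta> * F \<beta>)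
    = (\<Sum>\<gamma> | l1_norm \<gamma> = int m. carleman_fourier_entry gc t \<alpha> (\<alpha> + \<gamma>) * F (\<alpha> + \<gamma>))"
  using t by (intro sum_shifted_shell[OF \<alpha>]) (simp add: entry_eq_0)

text \<open>
  Inserting the exact modes into the truncated system leaves the tail of the rate, of order
  \<open>(r / R) ^ (N - k + 1)\<close>, times the mode itself, of order \<open>r ^ k\<close>. The product is
  \<open>R ^ k * (r / R) ^ (N + 1)\<close>, so after scaling level \<open>k\<close> by \<open>R ^ k\<close> the defect is
  equally small at all levels, up to the factor \<open>k\<close>.
\<close>
lemma truncation_defect:
  assumes \<alpha>: "\<alpha> \<in> nonneg_indices_of_order k" and t: "t \<ge> 0" and k: "k \<le> N"
    and r: "0 < r" "r < R" and x: "\<And>j. - ln r \<le> Im (x $ j)"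
  shows "cmod (\<i> * (\<Sum>j\<in>UNIV. of_int (\<alpha> $ j) * g t x $ j) * fourier_mode \<alpha> x
      - (\<Sum>l=k..N. \<Sum>\<beta>\<in>nonneg_indices_of_order l. carleman_fourier_entry gc t \<alpha> \<beta> * fourier_mode \<beta> x))
    \<le> real k * D * R ^ k * ((r / R) ^ (N + 1) / (1 - r / R))"
proof -
  let ?rate = "\<i> * (\<Sum>j\<in>UNIV. of_int (\<alpha> $ j) * g t x $ j)"
  let ?part = "\<Sum>m\<le>N - k. \<Sum>\<gamma> | l1_norm \<gamma> = int m.
      carleman_fourier_entry gc t \<alpha> (\<alpha> + \<gamma>) * fourier_mode \<gamma> x"
  have "(\<Sum>l=k..N. \<Sum>\<beta>\<in>nonneg_indices_of_order l. carleman_fourier_entry gc t \<alpha> \<beta> * fourier_mode \<beta> x)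
      = (\<Sum>m\<le>N - k. \<Sum>\<beta>\<in>nonneg_indices_of_order (k + m).
          carleman_fourier_entry gc t \<alpha> \<beta> * fourier_mode \<beta> x)"
    using k by (intro sum.reindex_bij_witness[where i = "\<lambda>m. k + m" and j = "\<lambda>l. l - k"]) auto
  also have "\<dots> = ?part * fourier_mode \<alpha> x"
    unfolding sum_level_entries[OF \<alpha> t] fourier_mode_add sum_distrib_right
    by (simp only: mult_ac)
  finally have "cmod (?rate * fourier_mode \<alpha> x - (\<Sum>l=k..N. \<Sum>\<beta>\<in>nonneg_indices_of_order l.
      carleman_fourier_entry gc t \<alpha> \<beta> * fourier_mode \<beta> x))
      = cmod (?rate - ?part) * cmod (fourier_mode \<alpha> x)"
    by (simp only: left_diff_distrib[symmetric] norm_mult)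
  also have "\<dots> \<le> (real k * D * ((r / R) ^ (N - k + 1) / (1 - r / R))) * r ^ k"
    using mode_rate_tail[OF \<alpha> t r x] cmod_fourier_mode_le[of \<alpha> k r x] \<alpha> r x D_pos
    by (intro mult_mono) (auto simp: nonneg_indices_of_order_def)
  also have "\<dots> = real k * D * R ^ k * ((r / R) ^ (N - k + 1) * (r / R) ^ k / (1 - r / R))"
    using R_pos by (simp add: power_divide)
  also have "(r / R) ^ (N - k + 1) * (r / R) ^ k = (r / R) ^ (N + 1)"
    using k by (simp only: power_add[symmetric]) simp
  finally show ?thesis .
qed

text \<open>
  The error at level \<open>k\<close> is driven by the defect and by the errors of the higher levels only, so
  downward induction on \<open>k\<close> applies. The driving term and the damping both carry a factor \<open>k\<close>,
  which cancels in the balance of \<open>damped_linear_ode_bound\<close>; what remains is the recursion solved by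
  \<open>geometric_feedback\<close>.
\<close>
lemma finite_section_error:
  assumes ivp: "solves_ivp g x0 x" and sec: "solves_finite_section gc x0 N v"
    and r: "0 < r" "r < \<mu> * R / (D + \<mu>)" and init: "\<And>j. - ln r \<le> Im (x0 $ j)"
    and k: "1 \<le> k" "k \<le> N" and \<alpha>: "\<alpha> \<in> nonneg_indices_of_order k" and t: "t \<ge> 0"
  shows "cmod (v k t \<alpha> - fourier_mode \<alpha> (x t))
    \<le> R ^ k * (D / \<mu>) * (1 + D / \<mu>) ^ (N - k) * ((r / R) ^ (N + 1) / (1 - r / R))"
  using k \<alpha> t
proof (induction "N - k" arbitrary: k \<alpha> t rule: less_induct)
  case less
  define E where "E = (r / R) ^ (N + 1) / (1 - r / R)"
  define \<delta> where "\<delta> = D / \<mu>"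
  define c where "c l = R ^ l * \<delta> * (1 + \<delta>) ^ (N - l) * E" for l
  define e where "e l s \<beta> = v l s \<beta> - fourier_mode \<beta> (x s)" for l s \<beta>
  define upper where "upper s = (\<Sum>l=Suc k..N. \<Sum>\<beta>\<in>nonneg_indices_of_order l.
      carleman_fourier_entry gc s \<alpha> \<beta> * e l s \<beta>)" for s
  define defect where "defect s =
      \<i> * (\<Sum>j\<in>UNIV. of_int (\<alpha> $ j) * g s (x s) $ j) * fourier_mode \<alpha> (x s)
      - (\<Sum>l=k..N. \<Sum>\<beta>\<in>nonneg_indices_of_order l.
          carleman_fourier_entry gc s \<alpha> \<beta> * fourier_mode \<beta> (x s))" for s
  have "r < R" using r R_pos D_pos \<mu>_pos
    by (smt (verit) divide_less_eq mult.commute mult_less_cancel_left_pos)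
  then have E: "E \<ge> 0" using r by (simp add: E_def)
  have \<delta>: "\<delta> > 0" using D_pos \<mu>_pos by (simp add: \<delta>_def)
  \<comment> \<open>The diagonal entry acts as damping on the error itself; the higher levels and the defect act
    as forcing.\<close>
  have "cmod (e k t \<alpha>) \<le> c k"
  proof (rule damped_linear_ode_bound[where \<kappa> = "real k * \<mu>"
        and \<sigma> = "\<lambda>s. carleman_fourier_entry gc s \<alpha> \<alpha>" and h = "\<lambda>s. upper s - defect s"])
    fix s :: real assume s: "s \<ge> 0"
    \<comment> \<open>The diagonal block is a diagonal matrix: its sphere of radius zero is a single point.\<close>
    have diag: "(\<Sum>\<beta>\<in>nonneg_indices_of_order k. carleman_fourier_entry gc s \<alpha> \<beta> * F \<beta>)
        = carleman_fourier_entry gc s \<alpha> \<alpha> * F \<alpha>" for F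
      using sum_level_entries[OF less.prems(3) s, where m = 0 and F = F] by (simp add: zero_shell)
    have "((\<lambda>s. v k s \<alpha>) has_vector_derivative
        (\<Sum>l=k..N. \<Sum>\<beta>\<in>nonneg_indices_of_order l. carleman_fourier_entry gc s \<alpha> \<beta> * v l s \<beta>))
        (at s within {0..})"
      using sec less.prems s by (auto simp: solves_finite_section_def)
    from has_vector_derivative_diff[OF this has_vector_derivative_fourier_mode[OF ivp s, of \<alpha>]]
    have "((\<lambda>s. e k s \<alpha>) has_vector_derivative
        (\<Sum>l=k..N. \<Sum>\<beta>\<in>nonneg_indices_of_order l. carleman_fourier_entry gc s \<alpha> \<beta> * e l s \<beta>)
          - defect s) (at s within {0..})"
      by (simp add: e_def defect_def right_diff_distrib sum_subtractf)
    also have "(\<Sum>l=k..N. \<Sum>\<beta>\<in>nonneg_indices_of_order l. carleman_fourier_entry gc s \<alpha> \<beta> * e l s \<beta>)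
        = carleman_fourier_entry gc s \<alpha> \<alpha> * e k s \<alpha> + upper s"
      using less.prems by (simp add: sum.atLeast_Suc_atMost diag upper_def)
    finally show "((\<lambda>s. e k s \<alpha>) has_vector_derivative
        carleman_fourier_entry gc s \<alpha> \<alpha> * e k s \<alpha> + (upper s - defect s)) (at s within {0..})"
      by (simp add: add_diff_eq)
    show "Re (carleman_fourier_entry gc s \<alpha> \<alpha>) \<le> - (real k * \<mu>)"
      using less.prems(3) s by (rule Re_diagonal_entry_le)
    \<comment> \<open>In the product of row sum and error bound the powers of \<open>R\<close> combine to \<open>R ^ k\<close>, whatever
      the level \<open>l\<close>.\<close>
    have level: "cmod (\<Sum>\<beta>\<in>nonneg_indices_of_order l. carleman_fourier_entry gc s \<alpha> \<beta> * e l s \<beta>)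
        \<le> real k * D * R ^ k * E * \<delta> * (1 + \<delta>) ^ (N - l)" if l: "l \<in> {Suc k..N}" for l
    proof -
      have cl: "c l \<ge> 0" using E \<delta> R_pos by (simp add: c_def)
      have "cmod (\<Sum>\<beta>\<in>nonneg_indices_of_order l. carleman_fourier_entry gc s \<alpha> \<beta> * e l s \<beta>)
          \<le> (\<Sum>\<beta>\<in>nonneg_indices_of_order l. cmod (carleman_fourier_entry gc s \<alpha> \<beta>) * c l)"
      proof (rule sum_norm_le)
        fix \<beta> :: "int ^ 'd" assume "\<beta> \<in> nonneg_indices_of_order l"
        then have "cmod (e l s \<beta>) \<le> c l"
          using less.hyps[of l \<beta> s] l s by (auto simp: e_def c_def E_def \<delta>_def)
        then show "cmod (carleman_fourier_entry gc s \<alpha> \<beta> * e l s \<beta>)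
            \<le> cmod (carleman_fourier_entry gc s \<alpha> \<beta>) * c l"
          by (simp add: norm_mult mult_left_mono)
      qed
      also have "\<dots> = (\<Sum>\<beta>\<in>nonneg_indices_of_order (k + (l - k)).
          cmod (carleman_fourier_entry gc s \<alpha> \<beta>)) * c l"
        using l by (simp add: sum_distrib_right)
      also have "\<dots> = (\<Sum>\<gamma> | l1_norm \<gamma> = int (l - k).
          cmod (carleman_fourier_entry gc s \<alpha> (\<alpha> + \<gamma>))) * c l"
        using s by (subst sum_shifted_shell[OF less.prems(3)]) (simp_all add: entry_eq_0)
      also have "\<dots> \<le> real k * (D / R ^ (l - k)) * c l"
        using entry_shell_bound[OF less.prems(3) s] cl by (intro mult_right_mono)
      also have "\<dots> = real k * D * (R ^ l / R ^ (l - k)) * E * \<delta> * (1 + \<delta>) ^ (N - l)"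
        by (simp add: c_def)
      also have "R ^ l / R ^ (l - k) = R ^ k"
        using l R_pos by (simp add: power_diff)
      finally show ?thesis .
    qed
    have "cmod (upper s) \<le> (\<Sum>l=Suc k..N. real k * D * R ^ k * E * \<delta> * (1 + \<delta>) ^ (N - l))"
      unfolding upper_def by (intro sum_norm_le level)
    also have "\<dots> = real k * D * R ^ k * E * (\<delta> * (\<Sum>l=Suc k..N. (1 + \<delta>) ^ (N - l)))"
      by (simp add: sum_distrib_left mult.assoc)
    finally have up: "cmod (upper s) \<le> \<dots>" .
    have "cmod (defect s) \<le> real k * D * R ^ k * E"
      unfolding defect_def E_def
      using solution_modes_bounded[OF ivp s r init]
      by (intro truncation_defect less.prems s r \<open>r < R\<close>)
    with up have "cmod (upper s - defect s)
        \<le> real k * D * R ^ k * E * (\<delta> * (\<Sum>l=Suc k..N. (1 + \<delta>) ^ (N - l)) + 1)"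
      unfolding distrib_left mult_1_right by (intro order_trans[OF norm_triangle_ineq4] add_mono)
    also have "\<dots> = real k * \<mu> * c k"
      unfolding geometric_feedback[OF less.prems(2)] c_def
      using \<mu>_pos by (simp add: \<delta>_def)
    finally show "cmod (upper s - defect s) \<le> real k * \<mu> * c k" .
  next
    \<comment> \<open>Section and exact modes start from the same values.\<close>
    have "e k 0 \<alpha> = 0"
      using ivp sec less.prems by (auto simp: e_def solves_ivp_def solves_finite_section_def)
    then show "cmod (e k 0 \<alpha>) \<le> c k" using E \<delta> R_pos by (simp add: c_def)
  qed (use less.prems \<mu>_pos in auto)
  then show ?case by (simp only: e_def c_def E_def \<delta>_def)
qed

end

text \<open>
  The 2-norm of the initial modes serves only as an upper bound for the modulus of each component.
\<close>
lemma norm_exp_i_component: "- ln (norm (exp_i x)) \<le> Im (x $ j)"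
proof -
  have "exp (- Im (x $ j)) = cmod (exp_i x $ j)" by (simp add: exp_i_def)
  also have "\<dots> \<le> norm (exp_i x)" by (rule Finite_Cartesian_Product.norm_nth_le)
  finally have "ln (exp (- Im (x $ j))) \<le> ln (norm (exp_i x))"
    by (subst ln_le_cancel_iff) (auto intro: less_le_trans[OF exp_gt_zero])
  then show ?thesis by simp
qed

text \<open>
  Converts the constant of the error estimate at level one into a pure power, trading the factor
  \<open>z / (1 - z)\<close> for \<open>1 + \<delta>\<close>. The damping is part of the field, which is why
  \<open>\<delta> \<ge> 1\<close> can be assumed; for small \<open>\<delta>\<close> and \<open>z\<close> near \<open>1 / (1 + \<delta>)\<close> the inequality fails.
\<close>
lemma first_block_constant_le:
  fixes z \<delta> :: real
  assumes \<delta>: "\<delta> \<ge> 1" and z: "0 \<le> z" "z < 1 / (1 + \<delta>)" and N: "N \<ge> 1"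
  shows "(1 + \<delta>) ^ (N - 1) * (z ^ (N + 1) / (1 - z)) \<le> ((1 + \<delta>) * z) ^ N"
proof -
  have "z * (1 + \<delta>) < 1" using z \<delta> by (simp add: pos_less_divide_eq)
  moreover have "0 \<le> z * \<delta>" using z \<delta> by simp
  ultimately have z1: "z < 1" by (simp add: algebra_simps)
  with \<open>z * (1 + \<delta>) < 1\<close> have "z \<le> (1 + \<delta>) * (1 - z)"
    using \<delta> by (auto simp: algebra_simps)
  then have "z / (1 - z) \<le> 1 + \<delta>" using z1 by (simp add: pos_divide_le_eq)
  then have "(1 + \<delta>) ^ (N - 1) * z ^ N * (z / (1 - z)) \<le> (1 + \<delta>) ^ (N - 1) * z ^ N * (1 + \<delta>)"
    using \<delta> z by (intro mult_left_mono) auto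
  also have "\<dots> = ((1 + \<delta>) ^ (N - 1) * (1 + \<delta>)) * z ^ N" by simp
  also have "(1 + \<delta>) ^ (N - 1) * (1 + \<delta>) = (1 + \<delta>) ^ N"
    using N power_Suc2[of "1 + \<delta>" "N - 1"] by simp
  finally show ?thesis by (simp add: power_mult_distrib mult_ac)
qed

theorem theorem3p3:
  fixes D\<^sub>0 R \<mu>\<^sub>0 :: real
    and g :: "real \<Rightarrow> complex ^ 'd::finite \<Rightarrow> complex ^ 'd"
    and gc :: "real \<Rightarrow> int ^ 'd \<Rightarrow> complex ^ 'd"
    and x :: "real \<Rightarrow> complex ^ 'd"
    and x\<^sub>0 :: "complex ^ 'd"
    and N :: nat
    and v :: "nat \<Rightarrow> real \<Rightarrow> int ^ 'd \<Rightarrow> complex"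
  assumes "D\<^sub>0 > 0" and "R > 0" and "\<mu>\<^sub>0 > 0"
    and "periodic_field g"
    and "has_fourier_expansion g gc R"
    and "\<And>\<alpha> t. \<alpha> \<notin> nonneg_indices \<Longrightarrow> t \<ge> 0 \<Longrightarrow> gc t \<alpha> = 0"
    and "\<And>(k::nat) t. t \<ge> 0 \<Longrightarrow>
           (\<Sum>\<alpha> | l1_norm \<alpha> = int k. \<Sum>j\<in>UNIV. cmod (gc t \<alpha> $ j)) \<le> D\<^sub>0 * R powi (- int k)"
    and "\<And>t. t \<ge> 0 \<Longrightarrow> (MIN j. Im (gc t 0 $ j)) \<ge> \<mu>\<^sub>0"
    and "solves_ivp g x\<^sub>0 x"
    and "norm (exp_i x\<^sub>0) < \<mu>\<^sub>0 * R / (D\<^sub>0 + \<mu>\<^sub>0)"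
    and "N \<ge> 1"
    and "solves_finite_section gc x\<^sub>0 N v"
  shows "\<forall>t\<ge>0. linf_norm (first_block v t - exp_i (x t))
           \<le> D\<^sub>0 * R / \<mu>\<^sub>0 * ((D\<^sub>0 + \<mu>\<^sub>0) * norm (exp_i x\<^sub>0) / (\<mu>\<^sub>0 * R)) ^ N"
proof -
  interpret dissipative_field D\<^sub>0 R \<mu>\<^sub>0 g gc
  proof
    fix m :: nat and t :: real assume "t \<ge> 0"
    then show "(\<Sum>\<gamma> | l1_norm \<gamma> = int m. \<Sum>j\<in>UNIV. cmod (gc t \<gamma> $ j)) \<le> D\<^sub>0 / R ^ m"
      using assms(7)[of t m] by (simp add: power_int_minus divide_inverse)
  next
    fix t :: real and j assume "t \<ge> 0"
    then show "\<mu>\<^sub>0 \<le> Im (gc t 0 $ j)"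
      using assms(8)[of t] Min_le[of "range (\<lambda>j. Im (gc t 0 $ j))" "Im (gc t 0 $ j)"] by simp
  qed (use assms in auto)
  define r where "r = norm (exp_i x\<^sub>0)"
  define \<delta> where "\<delta> = D\<^sub>0 / \<mu>\<^sub>0"
  have r: "0 < r" "r < \<mu>\<^sub>0 * R / (D\<^sub>0 + \<mu>\<^sub>0)"
    using assms(10) by (auto simp: r_def exp_i_def vec_eq_iff)
  have \<delta>: "\<delta> \<ge> 1" "1 + \<delta> = (D\<^sub>0 + \<mu>\<^sub>0) / \<mu>\<^sub>0"
    using assms(1,3) dissipation_le_size by (auto simp: \<delta>_def field_simps)
  have z: "0 \<le> r / R" "r / R < 1 / (1 + \<delta>)"
    using r assms(1-3) by (auto simp: \<delta>(2) field_simps)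
  have q: "(D\<^sub>0 + \<mu>\<^sub>0) * r / (\<mu>\<^sub>0 * R) = (1 + \<delta>) * (r / R)" by (simp add: \<delta>(2))
  show ?thesis
  proof (intro allI impI)
    fix t :: real assume t: "t \<ge> 0"
    have "cmod ((first_block v t - exp_i (x t)) $ j) \<le> D\<^sub>0 * R / \<mu>\<^sub>0 * ((1 + \<delta>) * (r / R)) ^ N" for j
    proof -
      have "cmod ((first_block v t - exp_i (x t)) $ j)
          = cmod (v 1 t (axis j 1) - fourier_mode (axis j 1) (x t))"
        by (simp add: first_block_def exp_i_def fourier_mode_axis)
      also have "\<dots> \<le> R ^ 1 * \<delta> * (1 + \<delta>) ^ (N - 1) * ((r / R) ^ (N + 1) / (1 - r / R))"
        unfolding \<delta>_def
        using norm_exp_i_component[of x\<^sub>0] assms t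
        by (intro finite_section_error[OF _ _ r] axis_in_order_1) (auto simp: r_def)
      also have "\<dots> = D\<^sub>0 * R / \<mu>\<^sub>0 * ((1 + \<delta>) ^ (N - 1) * ((r / R) ^ (N + 1) / (1 - r / R)))"
        by (simp add: \<delta>_def)
      also have "\<dots> \<le> D\<^sub>0 * R / \<mu>\<^sub>0 * ((1 + \<delta>) * (r / R)) ^ N"
        using first_block_constant_le[OF \<delta>(1) z assms(11)] assms(1-3) by (intro mult_left_mono) auto
      finally show ?thesis .
    qed
    then show "linf_norm (first_block v t - exp_i (x t))
        \<le> D\<^sub>0 * R / \<mu>\<^sub>0 * ((D\<^sub>0 + \<mu>\<^sub>0) * norm (exp_i x\<^sub>0) / (\<mu>\<^sub>0 * R)) ^ N"
      unfolding linf_norm_def r_def[symmetric] q by (intro Max.boundedI) auto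
  qed
qed

end
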